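(* Let $k$ be a fixed positive integer. For $n\ge k$ let $\lambda$ be a uniformly random composition of $n$, and let $N_{n,k}$ be the number of parts of $\lambda$ equal to $k$. Put $$\mu_{n,k}=\frac{n-k+3}{2^{k+1}},\qquad \sigma_{n,k}^2=\frac{(2^{k+1}-2k+3)\,n+3k(k-4)+(3-k)2^{k+1}+5}{4^{k+1}}.$$ Then $N_{n,k}$ is asymptotically normal with mean $\mu_{n,k}$ and variance $\sigma_{n,k}^2$; that is, as $n\to\infty$, $(N_{n,k}-\mu_{n,k})/\sigma_{n,k}$ converges in distribution to $N(0,1)$.
   Context: A composition of $n$ is an ordered list of positive integers (its parts) whose sum is $n$; there are $2^{n-1}$ compositions of $n$. $\sigma_{n,k}$ denotes the positive square root of $\sigma_{n,k}^2$, which is positive for all sufficiently large $n$. *)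

theory Defs
  imports "HOL-Probability.Probability"
begin

definition compositions :: "nat \<Rightarrow> nat list set" where
  "compositions n = {xs. (\<forall>x\<in>set xs. 0 < x) \<and> sum_list xs = n}"

lemma compositions_0: "compositions 0 = {[]}"
proof -
  have "xs = []" if "\<forall>x\<in>set xs. 0 < x" "sum_list xs = 0" for xs :: "nat list"
    using that by (cases xs) auto
  then show ?thesis by (auto simp: compositions_def)
qed

lemma finite_compositions: "finite (compositions n)"
proof (rule finite_subset)
  have "length xs \<le> sum_list xs" if "\<forall>x\<in>set xs. 0 < x" for xs :: "nat list"
    using that by (induction xs) auto
  then show "compositions n \<subseteq> {xs. set xs \<subseteq> {..n} \<and> length xs \<le> n}"
    by (auto simp: compositions_def dest: member_le_sum_list)
  show "finite {xs. set xs \<subseteq> {..n} \<and> length xs \<le> n}"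
    by (rule finite_lists_length_le) simp
qed

lemma compositions_nonempty: "compositions n \<noteq> {}"
proof (cases "n = 0")
  case False
  then have "[n] \<in> compositions n" by (simp add: compositions_def)
  then show ?thesis by blast
qed (simp add: compositions_0)

lemma card_compositions_Suc: "card (compositions (Suc n)) = 2 ^ n"
proof (induction n)
  case 0
  have "xs = [1]" if "\<forall>x\<in>set xs. 0 < x" "sum_list xs = Suc 0" for xs :: "nat list"
  proof (cases xs)
    case (Cons y ys)
    with that have y: "0 < y" "y + sum_list ys = 1" and pos: "\<forall>x\<in>set ys. 0 < x"
      by simp_all
    from y have "y = 1" "sum_list ys = 0" by linarith+
    with pos have "ys \<in> compositions 0" by (simp add: compositions_def)
    with Cons \<open>y = 1\<close> show ?thesis by (simp add: compositions_0)
  qed (use that in auto)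
  then have "compositions (Suc 0) = {[1]}" by (auto simp: compositions_def)
  then show ?case by simp
next
  case (Suc n)
  let ?C = "compositions (Suc n)"
  let ?f = "\<lambda>xs. Suc (hd xs) # tl xs"
  have ne: "xs \<noteq> []" if "xs \<in> ?C" for xs using that by (auto simp: compositions_def)
  have split: "compositions (Suc (Suc n)) = (#) 1 ` ?C \<union> ?f ` ?C"
  proof (intro equalityI subsetI)
    fix xs assume xs: "xs \<in> compositions (Suc (Suc n))"
    then obtain y ys where [simp]: "xs = y # ys" by (cases xs) (auto simp: compositions_def)
    show "xs \<in> (#) 1 ` ?C \<union> ?f ` ?C"
    proof (cases "y = 1")
      case True
      with xs show ?thesis by (auto simp: compositions_def)
    next
      case False
      with xs have "(y - 1) # ys \<in> ?C" "xs = ?f ((y - 1) # ys)"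
        by (auto simp: compositions_def)
      then show ?thesis by blast
    qed
  next
    fix xs assume "xs \<in> (#) 1 ` ?C \<union> ?f ` ?C"
    then consider ys where "ys \<in> ?C" "xs = 1 # ys" | ys where "ys \<in> ?C" "xs = ?f ys" by blast
    then show "xs \<in> compositions (Suc (Suc n))"
    proof cases
      case 1
      then show ?thesis by (auto simp: compositions_def)
    next
      case (2 ys)
      then show ?thesis using ne[OF 2(1)] by (cases ys) (auto simp: compositions_def)
    qed
  qed
  have "inj_on ?f ?C"
    by (rule inj_onI) (metis ne list.expand list.inject nat.inject)
  moreover have "(#) 1 ` ?C \<inter> ?f ` ?C = {}"
  proof -
    have "hd xs \<noteq> 0" if "xs \<in> ?C" for xs
      using that ne[OF that] by (cases xs) (auto simp: compositions_def)
    then show ?thesis by fastforce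
  qed
  ultimately show ?case
    using Suc.IH by (simp add: split card_Un_disjoint finite_compositions card_image)
qed

definition random_composition :: "nat \<Rightarrow> nat list pmf" where
  "random_composition n = pmf_of_set (compositions n)"

definition mean_parts :: "nat \<Rightarrow> nat \<Rightarrow> real" where
  "mean_parts n k = (real n - real k + 3) / 2 ^ (k + 1)"

definition var_parts :: "nat \<Rightarrow> nat \<Rightarrow> real" where
  "var_parts n k =
     ((2 ^ (k + 1) - 2 * real k + 3) * real n + 3 * real k * (real k - 4)
       + (3 - real k) * 2 ^ (k + 1) + 5) / 4 ^ (k + 1)"

(* For fixed k, var_parts n k is positive for all large n, so sd_parts is eventually its positive
   square root; for small n it may be negative, and then sqrt yields a negative junk value. *)
definition sd_parts :: "nat \<Rightarrow> nat \<Rightarrow> real" where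
  "sd_parts n k = sqrt (var_parts n k)"

end

theory Submission
  imports Defs
begin

text \<open>
  The proof goes through characteristic functions and Levy's continuity theorem. Let
  \<open>F\<^sub>m(u)\<close> be the sum of \<open>u\<close> to the number of parts equal to \<open>k\<close>, over all compositions of
  \<open>m\<close>. The characteristic function of the normalised count is, up to a phase,
  \<open>F\<^sub>n(e\<^sup>s) / 2^(n - 1)\<close> at \<open>s = i t / \<sigma>\<close>, so what is needed is the growth of \<open>F\<^sub>n(e\<^sup>s)\<close> for
  imaginary \<open>s\<close> of order \<open>1 / \<surd>n\<close>.

  Splitting off the first part shows that \<open>f\<^sub>m = F\<^sub>m(u) / 2\<^sup>m\<close> satisfies, for \<open>m \<ge> k\<close>, the linear
  recurrence
  \<open>f(m + 1) = f(m) + (u - 1) 2^(-k) (f(m + 1 - k) - f(m - k) / 2)\<close>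
  (lemma \<open>part_poly_recurrence\<close>). At \<open>u = 1\<close> it says that \<open>f\<close> is constant. For \<open>u\<close> near
  \<open>1\<close> one expects \<open>f\<^sub>m \<approx> r\<^sup>m / 2\<close>, where \<open>r\<close> is the root near \<open>1\<close> of the characteristic
  equation \<open>r^(k + 1) = r\<^sup>k + (u - 1) 2^(-k) (r - 1/2)\<close>.

  No exact root and no singularity analysis is used. Solving the equation to second order at
  \<open>u = e\<^sup>s\<close> gives \<open>r = exp (a s + b s\<^sup>2)\<close> with \<open>a = 2^(-k - 1)\<close> and
  \<open>b = a / 2 + a\<^sup>2 (3/2 - k)\<close>, which satisfies it up to \<open>O(s\<^sup>3)\<close>
  (lemma \<open>characteristic_defect_cubic\<close>). Then \<open>e\<^sub>m = f\<^sub>m / r\<^sup>m\<close> satisfies a recurrence whose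
  increments are \<open>O(s\<^sup>3)\<close> plus \<open>O(s)\<close> times the previous \<open>k\<close> increments. Summed over \<open>n\<close>
  steps they contribute \<open>O(n s\<^sup>3 + s)\<close>, which tends to \<open>0\<close>
  (lemma \<open>perturbed_recurrence_nearly_constant\<close>), so \<open>e\<^sub>n\<close> has the same limit as \<open>e\<^sub>k\<close>,
  namely \<open>1/2\<close> (lemma \<open>part_poly_asymptotic\<close>).

  It remains to read off \<open>n (a s + b s\<^sup>2) - s \<mu>\<close>. The mean differs from \<open>a n\<close> by a constant and
  \<open>\<sigma>\<^sup>2\<close> differs from \<open>2 b n\<close> by a constant, so this exponent tends to \<open>- t\<^sup>2 / 2\<close>.
\<close>

section \<open>The generating polynomial of the number of parts equal to k\<close>

definition part_poly :: "nat \<Rightarrow> nat \<Rightarrow> 'a::comm_ring_1 \<Rightarrow> 'a" where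
  "part_poly k n u = (\<Sum>xs\<in>compositions n. u ^ count_list xs k)"

lemma compositions_Suc_eq_UN:
  "compositions (Suc n) = (\<Union>j\<le>n. (#) (Suc n - j) ` compositions j)"
proof (intro equalityI subsetI)
  fix xs assume xs: "xs \<in> compositions (Suc n)"
  then obtain y ys where [simp]: "xs = y # ys" by (cases xs) (auto simp: compositions_def)
  from xs have "sum_list ys \<le> n" "y = Suc n - sum_list ys" "ys \<in> compositions (sum_list ys)"
    by (auto simp: compositions_def)
  then show "xs \<in> (\<Union>j\<le>n. (#) (Suc n - j) ` compositions j)" by auto
qed (auto simp: compositions_def)

lemma part_poly_first_part:
  "part_poly k (Suc n) u = (\<Sum>j\<le>n. (if Suc n - j = k then u else 1) * part_poly k j u)"
proof -
  have "part_poly k (Suc n) u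
      = (\<Sum>j\<le>n. \<Sum>xs\<in>(#) (Suc n - j) ` compositions j. u ^ count_list xs k)"
    unfolding part_poly_def compositions_Suc_eq_UN
    by (rule sum.UNION_disjoint) (auto simp: finite_compositions)
  also have "\<dots> = (\<Sum>j\<le>n. \<Sum>xs\<in>compositions j. u ^ count_list ((Suc n - j) # xs) k)"
    by (rule sum.cong[OF refl], subst sum.reindex) (simp_all add: inj_on_def)
  also have "\<dots> = (\<Sum>j\<le>n. (if Suc n - j = k then u else 1) * part_poly k j u)"
    by (intro sum.cong refl) (simp add: part_poly_def sum_distrib_left)
  finally show ?thesis .
qed

text \<open>
  A first part of size \<open>k\<close> contributes \<open>u = 1 + (u - 1)\<close>. Subtracting two consecutive instances
  of this formula makes the sum over all smaller sizes telescope away.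
\<close>
lemma part_poly_eq_sum:
  assumes "k \<ge> 1" "k \<le> Suc n"
  shows "part_poly k (Suc n) u = (\<Sum>j\<le>n. part_poly k j u) + (u - 1) * part_poly k (Suc n - k) u"
proof -
  have "part_poly k (Suc n) u
      = (\<Sum>j\<le>n. part_poly k j u + (if j = Suc n - k then (u - 1) * part_poly k j u else 0))"
    unfolding part_poly_first_part using assms by (intro sum.cong) (auto simp: algebra_simps)
  also have "\<dots> = (\<Sum>j\<le>n. part_poly k j u) + (u - 1) * part_poly k (Suc n - k) u"
    using assms by (simp add: sum.distrib)
  finally show ?thesis .
qed

lemma part_poly_recurrence:
  assumes "k \<ge> 1" "k \<le> n"
  shows "part_poly k (Suc n) u
    = 2 * part_poly k n u + (u - 1) * (part_poly k (Suc n - k) u - part_poly k (n - k) u)"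
proof -
  from assms obtain m where n: "n = Suc m" by (cases n) auto
  have S: "(\<Sum>j\<le>m. part_poly k j u) = part_poly k n u - (u - 1) * part_poly k (n - k) u"
    using part_poly_eq_sum[of k m u] assms n by simp
  have "part_poly k (Suc n) u
      = (\<Sum>j\<le>m. part_poly k j u) + part_poly k n u + (u - 1) * part_poly k (Suc n - k) u"
    using part_poly_eq_sum[of k n u] assms n by simp
  then show ?thesis by (simp only: S) (simp add: algebra_simps)
qed

lemma card_compositions_le: "card (compositions n) \<le> 2 ^ n"
  by (cases n) (simp_all add: compositions_0 card_compositions_Suc)

lemma norm_part_poly_le:
  fixes u :: complex
  assumes "norm u = 1"
  shows "norm (part_poly k n u) \<le> 2 ^ n"
proof -
  have "norm (part_poly k n u) \<le> (\<Sum>xs\<in>compositions n. norm (u ^ count_list xs k))"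
    unfolding part_poly_def by (rule norm_sum)
  also have "\<dots> = real (card (compositions n))"
    using assms by (simp add: norm_power)
  also have "\<dots> \<le> real (2 ^ n)" by (subst of_nat_le_iff) (rule card_compositions_le)
  finally show ?thesis by simp
qed

section \<open>Stability of a perturbed constant recurrence\<close>

lemma norm_diff_le_sum_increments:
  fixes e :: "nat \<Rightarrow> 'a::real_normed_vector"
  assumes "a \<le> b"
  shows "norm (e b - e a) \<le> (\<Sum>j=a..<b. norm (e (Suc j) - e j))"
  using sum_Suc_diff'[OF assms, of e] by (metis norm_sum)

text \<open>
  Each increment of \<open>e\<close> is bounded by the defect \<open>\<delta>\<close> times \<open>E\<close>, plus \<open>|B| + |C|\<close> times the sum
  of the \<open>k\<close> preceding increments. When these bounds are added up, every increment is counted at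
  most \<open>k\<close> times on the right. If \<open>k (|B| + |C|) \<le> 1/2\<close>, the total variation of \<open>e\<close> can
  therefore be absorbed into the left side and is bounded by twice the initial variation plus
  twice the accumulated defect. Using this once more, the variation after index \<open>k\<close> is small even
  though the initial one need not be.
\<close>
lemma perturbed_recurrence_nearly_constant:
  fixes e :: "nat \<Rightarrow> 'a::real_normed_field"
  assumes k: "1 \<le> k" "k \<le> n"
    and rec: "\<And>m. k \<le> m \<Longrightarrow> m < n \<Longrightarrow>
      e (Suc m) - e m = \<delta> * e m - B * (e m - e (Suc m - k)) + C * (e m - e (m - k))"
    and E: "\<And>m. m \<le> n \<Longrightarrow> norm (e m) \<le> E"
    and small: "real k * (norm B + norm C) \<le> 1 / 2"
  shows "norm (e n - e k) \<le> real n * norm \<delta> * E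
    + 2 * (real k * (norm B + norm C)) * (2 * real k * E + real n * norm \<delta> * E)"
proof -
  \<comment> \<open>\<open>T\<close> is the total variation of \<open>e\<close> up to \<open>n\<close> and \<open>R\<close> the part of it that the recurrence governs.\<close>
  define d where "d j = norm (e (Suc j) - e j)" for j
  define b where "b = norm B + norm C"
  define X where "X = real n * norm \<delta> * E"
  define T where "T = (\<Sum>j<n. d j)"
  define R where "R = (\<Sum>m=k..<n. d m)"
  have b0: "0 \<le> b" by (simp add: b_def)
  have d0: "0 \<le> d j" for j by (simp add: d_def)
  have T0: "0 \<le> T" unfolding T_def by (intro sum_nonneg d0)
  have E0: "0 \<le> E" using E[of 0] norm_ge_zero order_trans by blast
  have X0: "0 \<le> X" by (simp add: X_def E0)
  have step: "d m \<le> norm \<delta> * E + b * (\<Sum>i<k. d (m - k + i))" if m: "k \<le> m" "m < n" for m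
  proof -
    define D where "D = (\<Sum>i<k. d (m - k + i))"
    have D: "D = (\<Sum>j=m-k..<m. d j)"
      unfolding D_def using m sum.shift_bounds_nat_ivl[of d 0 "m - k" k]
      by (simp add: atLeast0LessThan add.commute)
    have 1: "norm (e m - e (m - k)) \<le> D"
      unfolding D d_def by (rule norm_diff_le_sum_increments) simp
    have "norm (e m - e (Suc m - k)) \<le> (\<Sum>j=Suc m-k..<m. d j)"
      unfolding d_def by (rule norm_diff_le_sum_increments) (use k in simp)
    also have "\<dots> \<le> D"
      unfolding D by (rule sum_mono2) (auto simp: d0)
    finally have 2: "norm (e m - e (Suc m - k)) \<le> D" .
    have "d m \<le> norm (\<delta> * e m) + norm (B * (e m - e (Suc m - k))) + norm (C * (e m - e (m - k)))"
      unfolding d_def rec[OF m]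
      by (intro order.trans[OF norm_triangle_ineq] add_right_mono norm_triangle_ineq4)
    also have "\<dots> \<le> norm \<delta> * E + norm B * D + norm C * D"
      unfolding norm_mult using E[of m] m 1 2 by (intro add_mono mult_left_mono) auto
    finally show ?thesis by (simp add: D_def b_def algebra_simps)
  qed
  have window: "(\<Sum>m=k..<n. \<Sum>i<k. d (m - k + i)) \<le> real k * T"
  proof -
    have "(\<Sum>m=k..<n. d (m - k + i)) \<le> T" if "i < k" for i
    proof -
      have "(\<Sum>m=k..<n. d (m - k + i)) = sum d ((\<lambda>m. m - k + i) ` {k..<n})"
        by (subst sum.reindex) (auto simp: inj_on_def)
      also have "\<dots> \<le> T"
        unfolding T_def using that by (intro sum_mono2) (auto simp: d0)
      finally show ?thesis .
    qed
    then have "(\<Sum>i<k. \<Sum>m=k..<n. d (m - k + i)) \<le> (\<Sum>i<k. T)"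
      by (intro sum_mono) simp
    then show ?thesis by (subst sum.swap) simp
  qed
  have "R \<le> (\<Sum>m=k..<n. norm \<delta> * E + b * (\<Sum>i<k. d (m - k + i)))"
    unfolding R_def by (intro sum_mono step) auto
  also have "\<dots> = real (n - k) * (norm \<delta> * E) + b * (\<Sum>m=k..<n. \<Sum>i<k. d (m - k + i))"
    by (simp add: sum.distrib sum_distrib_left)
  also have "\<dots> \<le> X + b * (real k * T)"
  proof (intro add_mono mult_left_mono window b0)
    have "real (n - k) * (norm \<delta> * E) \<le> real n * (norm \<delta> * E)"
      using E0 by (intro mult_right_mono) auto
    then show "real (n - k) * (norm \<delta> * E) \<le> X" by (simp add: X_def mult.assoc)
  qed
  finally have R: "R \<le> X + (real k * b) * T" by (simp add: mult_ac)
  have init: "(\<Sum>j<k. d j) \<le> 2 * real k * E"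
  proof -
    have "d j \<le> 2 * E" if "j < k" for j
      using norm_triangle_ineq4[of "e (Suc j)" "e j"] E[of j] E[of "Suc j"] that k
      by (simp add: d_def)
    then have "(\<Sum>j<k. d j) \<le> (\<Sum>j<k. 2 * E)" by (intro sum_mono) simp
    then show ?thesis by simp
  qed
  have "T = (\<Sum>j<k. d j) + R"
    unfolding T_def R_def using k sum.atLeastLessThan_concat[of 0 k n d]
    by (simp add: atLeast0LessThan)
  moreover have "(real k * b) * T \<le> 1 / 2 * T"
    using small T0 unfolding b_def by (rule mult_right_mono)
  moreover have "T \<le> 2 * (Y + X)" if "T = I + R" "Q \<le> 1 / 2 * T" "R \<le> X + Q" "I \<le> Y" for I Q Y
    using that by simp
  ultimately have T: "T \<le> 2 * (2 * real k * E + X)" using R init by blast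
  have "norm (e n - e k) \<le> R"
    unfolding R_def d_def by (rule norm_diff_le_sum_increments) (use k in simp)
  also have "\<dots> \<le> X + (real k * b) * (2 * (2 * real k * E + X))"
    using R mult_left_mono[OF T, of "real k * b"] b0 by simp
  finally show ?thesis by (simp add: X_def b_def algebra_simps)
qed

section \<open>The dominant growth rate to second order\<close>

lemma exp_quadratic_expansion:
  fixes a b :: complex
  shows "\<exists>M. \<forall>s. norm s \<le> 1 \<longrightarrow>
    norm (exp (a * s + b * s\<^sup>2) - (1 + a * s + (b + a\<^sup>2 / 2) * s\<^sup>2)) \<le> M * norm s ^ 3"
proof (intro exI allI impI)
  define L where "L = norm a + norm b"
  fix s :: complex assume s: "norm s \<le> 1"
  define z where "z = a * s + b * s\<^sup>2"
  have L0: "0 \<le> L" by (simp add: L_def)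
  have "norm z \<le> norm a * norm s + norm b * (norm s * norm s)"
    unfolding z_def by (rule order.trans[OF norm_triangle_ineq]) (simp add: norm_mult power2_eq_square)
  also have "\<dots> \<le> norm a * norm s + norm b * norm s"
    using s by (intro add_left_mono mult_left_mono mult_left_le) auto
  finally have z: "norm z \<le> L * norm s" by (simp add: L_def algebra_simps)
  also have "\<dots> \<le> L" using s L0 by (rule mult_left_le)
  finally have zL: "norm z \<le> L" .
  have "norm (exp z - (1 + z + z\<^sup>2 / 2)) \<le> exp (norm z) * norm z ^ 3 / 2"
    using Taylor_exp_field[of z 2] by (simp add: numeral_2_eq_2 numeral_3_eq_3)
  also have "\<dots> \<le> exp L * (L * norm s) ^ 3 / 2"
    using z zL by (intro divide_right_mono mult_mono power_mono) auto
  finally have 1: "norm (exp z - (1 + z + z\<^sup>2 / 2)) \<le> exp L * L ^ 3 / 2 * norm s ^ 3"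
    by (simp add: power_mult_distrib)
  have "z\<^sup>2 / 2 - a\<^sup>2 / 2 * s\<^sup>2 = s ^ 3 * (a * b + b\<^sup>2 / 2 * s)"
    unfolding z_def by (simp add: field_simps power2_eq_square power3_eq_cube)
  then have "norm (z\<^sup>2 / 2 - a\<^sup>2 / 2 * s\<^sup>2) = norm s ^ 3 * norm (a * b + b\<^sup>2 / 2 * s)"
    by (simp add: norm_mult norm_power)
  also have "\<dots> \<le> norm s ^ 3 * (norm (a * b) + norm (b\<^sup>2 / 2))"
    using s by (intro mult_left_mono order.trans[OF norm_triangle_ineq] add_left_mono)
      (simp_all add: norm_mult norm_divide norm_power mult_left_le)
  finally have 2: "norm (z\<^sup>2 / 2 - a\<^sup>2 / 2 * s\<^sup>2) \<le> (norm (a * b) + norm (b\<^sup>2 / 2)) * norm s ^ 3"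
    by (simp only: mult.commute)
  have "exp z - (1 + a * s + (b + a\<^sup>2 / 2) * s\<^sup>2)
      = (exp z - (1 + z + z\<^sup>2 / 2)) + (z\<^sup>2 / 2 - a\<^sup>2 / 2 * s\<^sup>2)"
    by (simp add: z_def algebra_simps)
  then have "norm (exp z - (1 + a * s + (b + a\<^sup>2 / 2) * s\<^sup>2))
      \<le> exp L * L ^ 3 / 2 * norm s ^ 3 + (norm (a * b) + norm (b\<^sup>2 / 2)) * norm s ^ 3"
    by (simp only: norm_triangle_le[OF add_mono[OF 1 2]])
  then show "norm (exp (a * s + b * s\<^sup>2) - (1 + a * s + (b + a\<^sup>2 / 2) * s\<^sup>2))
      \<le> (exp L * L ^ 3 / 2 + (norm (a * b) + norm (b\<^sup>2 / 2))) * norm s ^ 3"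
    by (simp only: distrib_right z_def)
qed

text \<open>The limit of \<open>var_parts n k / n\<close>, and twice the quadratic coefficient of the growth rate.\<close>
definition var_rate :: "nat \<Rightarrow> real" where
  "var_rate k = (2 ^ (k + 1) - 2 * real k + 3) / 4 ^ (k + 1)"

text \<open>
  The logarithm of the root near \<open>1\<close> of \<open>x^(k + 1) = x\<^sup>k + (e\<^sup>s - 1) 2^(-k) (x - 1/2)\<close>,
  expanded to second order at \<open>s = 0\<close>.
\<close>
definition log_growth :: "nat \<Rightarrow> complex \<Rightarrow> complex" where
  "log_growth k s = of_real (1 / 2 ^ (k + 1)) * s + of_real (var_rate k / 2) * s\<^sup>2"

text \<open>
  The characteristic equation at \<open>exp (log_growth k s)\<close> is a linear combination of a constant and
  exponentials of quadratics in \<open>s\<close>. Expanding each of them to second order, the linear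
  terms cancel because the linear coefficient of \<open>log_growth\<close> is \<open>2^(-k - 1)\<close>, and the
  quadratic terms cancel because of the value of \<open>var_rate k\<close>.
\<close>
lemma characteristic_defect_cubic:
  "\<exists>M. \<forall>s. norm s \<le> 1 \<longrightarrow>
    norm (exp (log_growth k s) ^ k - exp (log_growth k s) ^ (k + 1)
      + (exp s - 1) / 2 ^ k * (exp (log_growth k s) - 1 / 2)) \<le> M * norm s ^ 3"
proof -
  define a :: complex where "a = 1 / 2 ^ (k + 1)"
  define b :: complex where "b = of_real (var_rate k / 2)"
  define p :: complex where "p = 1 / 2 ^ k"
  define \<kappa> :: complex where "\<kappa> = of_nat k"
  have p: "p = 2 * a" by (simp add: p_def a_def)
  have b: "b = a / 2 + a\<^sup>2 * (3 / 2 - \<kappa>)"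
  proof -
    have "(4::complex) ^ (k + 1) = 2 ^ (k + 1) * 2 ^ (k + 1)"
      by (simp flip: power_mult_distrib)
    then show ?thesis
      by (simp add: b_def a_def var_rate_def \<kappa>_def field_simps power2_eq_square)
  qed
  have lg: "log_growth k s = a * s + b * s\<^sup>2" for s
    by (simp add: log_growth_def a_def b_def)
  have pw: "exp (log_growth k s) ^ j = exp ((of_nat j * a) * s + (of_nat j * b) * s\<^sup>2)" for j s
    by (simp add: lg algebra_simps flip: exp_of_nat_mult)
  \<comment> \<open>Second-order Taylor polynomial and remainder of \<open>exp (c s + d s\<^sup>2)\<close>.\<close>
  define P where "P c d s = 1 + c * s + (d + c\<^sup>2 / 2) * s\<^sup>2" for c d s :: complex
  define R where "R c d s = exp (c * s + d * s\<^sup>2) - P c d s" for c d s :: complex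
  have "\<exists>M. \<forall>s. norm s \<le> 1 \<longrightarrow> norm (R c d s) \<le> M * norm s ^ 3" for c d
    unfolding R_def P_def by (rule exp_quadratic_expansion)
  then obtain M where M: "\<And>c d s. norm s \<le> 1 \<Longrightarrow> norm (R c d s) \<le> M c d * norm s ^ 3"
    by metis
  define N where "N = M (\<kappa> * a) (\<kappa> * b) + M ((\<kappa> + 1) * a) ((\<kappa> + 1) * b)
    + norm p * M (1 + a) b + norm p * M a b + norm (p / 2) * M 1 0"
  show ?thesis
  proof (intro exI[of _ N] allI impI)
    fix s :: complex assume s: "norm s \<le> 1"
    let ?R1 = "R (\<kappa> * a) (\<kappa> * b) s" and ?R2 = "R ((\<kappa> + 1) * a) ((\<kappa> + 1) * b) s"
    let ?R3 = "R (1 + a) b s" and ?R4 = "R a b s" and ?R5 = "R 1 0 s"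
    have e: "exp (c * s + d * s\<^sup>2) = P c d s + R c d s" for c d by (simp add: R_def)
    have "exp s * exp (log_growth k s) = exp ((1 + a) * s + b * s\<^sup>2)"
      by (simp add: lg algebra_simps flip: exp_add)
    moreover have "exp s = exp (1 * s + 0 * s\<^sup>2)" by simp
    ultimately have prods: "exp s * exp (log_growth k s) = P (1 + a) b s + ?R3" "exp s = P 1 0 s + ?R5"
      "exp (log_growth k s) = P a b s + ?R4"
      by (simp_all only: e lg)
    have pows: "exp (log_growth k s) ^ k = P (\<kappa> * a) (\<kappa> * b) s + ?R1"
      "exp (log_growth k s) ^ (k + 1) = P ((\<kappa> + 1) * a) ((\<kappa> + 1) * b) s + ?R2"
      unfolding pw e by (simp_all only: \<kappa>_def of_nat_add of_nat_1)
    have "exp (log_growth k s) ^ k - exp (log_growth k s) ^ (k + 1)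
        + (exp s - 1) / 2 ^ k * (exp (log_growth k s) - 1 / 2)
      = exp (log_growth k s) ^ k - exp (log_growth k s) ^ (k + 1)
        + (p * (exp s * exp (log_growth k s)) - p * exp (log_growth k s) - p / 2 * exp s + p / 2)"
      by (simp add: p_def algebra_simps diff_divide_distrib add_divide_distrib)
    also have "\<dots> = (P (\<kappa> * a) (\<kappa> * b) s + ?R1) - (P ((\<kappa> + 1) * a) ((\<kappa> + 1) * b) s + ?R2)
        + (p * (P (1 + a) b s + ?R3) - p * (P a b s + ?R4) - p / 2 * (P 1 0 s + ?R5) + p / 2)"
      unfolding pows unfolding prods(1) unfolding prods(2,3) ..
    also have "\<dots> = ?R1 - ?R2 + p * ?R3 - p * ?R4 - p / 2 * ?R5"
      unfolding P_def p b by (simp add: field_simps power2_eq_square)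
    also have "norm \<dots> \<le> norm ?R1 + norm ?R2 + norm (p * ?R3) + norm (p * ?R4) + norm (p / 2 * ?R5)"
      by (intro order.trans[OF norm_triangle_ineq4] order.trans[OF norm_triangle_ineq]
          add_right_mono order.refl)
    also have "\<dots> \<le> M (\<kappa> * a) (\<kappa> * b) * norm s ^ 3 + M ((\<kappa> + 1) * a) ((\<kappa> + 1) * b) * norm s ^ 3
      + norm p * (M (1 + a) b * norm s ^ 3) + norm p * (M a b * norm s ^ 3)
      + norm (p / 2) * (M 1 0 * norm s ^ 3)"
      unfolding norm_mult by (intro add_mono mult_left_mono M s norm_ge_zero)
    also have "\<dots> = N * norm s ^ 3" by (simp only: N_def algebra_simps)
    finally show "norm (exp (log_growth k s) ^ k - exp (log_growth k s) ^ (k + 1)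
      + (exp s - 1) / 2 ^ k * (exp (log_growth k s) - 1 / 2)) \<le> N * norm s ^ 3" .
  qed
qed

section \<open>Asymptotics of the generating polynomial on the unit circle near 1\<close>

lemma var_rate_pos: "var_rate k > 0"
proof -
  have "real k < 2 ^ k" by (rule of_nat_less_two_power)
  moreover have "(2::real) ^ (k + 1) = 2 * 2 ^ k" by simp
  ultimately have "0 < 2 ^ (k + 1) - 2 * real k + 3" by linarith
  then show ?thesis unfolding var_rate_def by (rule divide_pos_pos) simp
qed

text \<open>
  On the imaginary axis the growth rate drops below \<open>1\<close> only to second order, so that
  \<open>r^(-m)\<close> stays bounded for \<open>m \<le> n\<close> as long as \<open>n |s|\<^sup>2\<close> is bounded.
\<close>
lemma norm_exp_log_growth:
  assumes "Re s = 0"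
  shows "norm (exp (log_growth k s)) = exp (- (var_rate k / 2 * (norm s)\<^sup>2))"
proof -
  have "Re (of_real a * s + of_real b * s\<^sup>2) = - (b * (norm s)\<^sup>2)" for a b
    using assms cmod_power2[of s] by (simp add: Re_power2)
  then show ?thesis by (simp only: norm_exp_eq_Re log_growth_def)
qed

lemma tendsto_zero_if_scaled_norm_bounded:
  fixes s :: "nat \<Rightarrow> 'a::real_normed_vector"
  assumes bounded: "\<And>n. real n * (norm (s n))\<^sup>2 \<le> K"
  shows "s \<longlonglongrightarrow> 0"
proof -
  have "(\<lambda>n. (norm (s n))\<^sup>2) \<longlonglongrightarrow> 0"
  proof (rule tendsto_sandwich[OF _ _ tendsto_const lim_const_over_n])
    show "\<forall>\<^sub>F n in sequentially. (norm (s n))\<^sup>2 \<le> K / real n"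
      using eventually_gt_at_top[of 0] by eventually_elim (use bounded in \<open>simp add: field_simps\<close>)
  qed simp
  then have "(\<lambda>n. sqrt ((norm (s n))\<^sup>2)) \<longlonglongrightarrow> sqrt 0" by (rule tendsto_real_sqrt)
  then show ?thesis by (simp add: tendsto_norm_zero_iff)
qed

text \<open>
  The quotient \<open>e n m\<close> of \<open>F\<^sub>m(e\<^sup>s) / 2\<^sup>m\<close> by \<open>r\<^sup>m\<close> is almost constant in \<open>m\<close> between \<open>k\<close> and
  \<open>n\<close>, since \<open>n |s|\<^sup>3 = (n |s|\<^sup>2) |s|\<close> tends to \<open>0\<close>. At \<open>m = k\<close> the quotient tends to the
  number of compositions of \<open>k\<close> divided by \<open>2\<^sup>k\<close>, which is \<open>1/2\<close>; the comparison cannot start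
  at \<open>m = 0\<close>, where the same ratio is \<open>1\<close>.
\<close>
lemma part_poly_asymptotic:
  fixes s :: "nat \<Rightarrow> complex"
  assumes k: "1 \<le> k"
    and imag: "\<And>n. Re (s n) = 0"
    and bounded: "\<And>n. real n * (norm (s n))\<^sup>2 \<le> K"
  shows "(\<lambda>n. part_poly k n (exp (s n)) / (2 ^ n * exp (of_nat n * log_growth k (s n)))) \<longlonglongrightarrow> 1 / 2"
proof -
  define r where "r n = exp (log_growth k (s n))" for n
  define w where "w n = exp (s n) - 1" for n
  define B where "B n = w n / 2 ^ k / r n ^ k" for n
  define C where "C n = w n / 2 ^ k / 2 / r n ^ (k + 1)" for n
  define \<delta> where "\<delta> n = 1 / r n - 1 + B n - C n" for n
  define e where "e n m = part_poly k m (exp (s n)) / (2 ^ m * r n ^ m)" for n m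
  define E where "E = exp (var_rate k / 2 * K)"
  define q where "q n = real k * (norm (B n) + norm (C n))" for n
  define X where "X n = real n * norm (\<delta> n) * E" for n
  have r0: "r n \<noteq> 0" for n by (simp add: r_def)
  have unit: "norm (exp (s n)) = 1" for n by (simp add: imag)
  have s0: "s \<longlonglongrightarrow> 0"
    by (rule tendsto_zero_if_scaled_norm_bounded[OF bounded])
  have r1: "r \<longlonglongrightarrow> 1"
  proof -
    have "r \<longlonglongrightarrow> exp (of_real (1 / 2 ^ (k + 1)) * 0 + of_real (var_rate k / 2) * 0\<^sup>2)"
      unfolding r_def log_growth_def by (intro tendsto_intros s0)
    then show ?thesis by simp
  qed
  have w0: "w \<longlonglongrightarrow> 0"
    unfolding w_def using tendsto_diff[OF tendsto_exp[OF s0] tendsto_const[of 1]] by simp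
  have "B \<longlonglongrightarrow> 0 / 2 ^ k / 1 ^ k" "C \<longlonglongrightarrow> 0 / 2 ^ k / 2 / 1 ^ (k + 1)"
    unfolding B_def C_def by (intro tendsto_intros w0 r1; simp)+
  then have "q \<longlonglongrightarrow> real k * (norm (0 / 2 ^ k / 1 ^ k :: complex)
      + norm (0 / 2 ^ k / 2 / 1 ^ (k + 1) :: complex))"
    unfolding q_def by (intro tendsto_intros)
  then have q0: "q \<longlonglongrightarrow> 0" by simp
  have X0: "X \<longlonglongrightarrow> 0"
  proof -
    obtain N where N: "\<And>z. norm z \<le> 1 \<Longrightarrow>
        norm (exp (log_growth k z) ^ k - exp (log_growth k z) ^ (k + 1)
          + (exp z - 1) / 2 ^ k * (exp (log_growth k z) - 1 / 2)) \<le> N * norm z ^ 3"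
      using characteristic_defect_cubic by blast
    have N0: "0 \<le> N" using order.trans[OF norm_ge_zero N[of 1]] by simp
    have ev: "\<forall>\<^sub>F n in sequentially. norm (X n) \<le> N * K * norm (s n) / norm (r n) ^ (k + 1) * E"
    proof -
      have "\<forall>\<^sub>F n in sequentially. norm (s n) < 1"
        using order_tendstoD(2)[OF tendsto_norm_zero[OF s0], of 1] by simp
      then show ?thesis
      proof eventually_elim
        case (elim n)
        \<comment> \<open>Clearing denominators turns \<open>\<delta>\<close> into the defect of the characteristic equation.\<close>
        have "\<delta> n * r n ^ (k + 1) = r n ^ k - r n ^ (k + 1) + w n / 2 ^ k * (r n - 1 / 2)"
          using r0[of n] by (simp add: \<delta>_def B_def C_def field_simps)
        then have "norm (\<delta> n) * norm (r n) ^ (k + 1) \<le> N * norm (s n) ^ 3"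
          using N[of "s n"] elim unfolding r_def w_def
          by (metis less_imp_le norm_mult norm_power)
        then have "real n * (norm (\<delta> n) * norm (r n) ^ (k + 1)) \<le> real n * (N * norm (s n) ^ 3)"
          by (rule mult_left_mono) simp
        also have "\<dots> = N * norm (s n) * (real n * (norm (s n))\<^sup>2)"
          by (simp add: power2_eq_square power3_eq_cube)
        also have "\<dots> \<le> N * norm (s n) * K"
          using N0 by (intro mult_left_mono bounded) auto
        finally have "real n * norm (\<delta> n) \<le> N * K * norm (s n) / norm (r n) ^ (k + 1)"
          using r0[of n] by (simp add: pos_le_divide_eq mult_ac)
        then have "real n * norm (\<delta> n) * E \<le> N * K * norm (s n) / norm (r n) ^ (k + 1) * E"
          by (rule mult_right_mono) (simp add: E_def)
        then show ?case by (simp add: X_def E_def)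
      qed
    qed
    have "(\<lambda>n. N * K * norm (s n) / norm (r n) ^ (k + 1) * E)
        \<longlonglongrightarrow> N * K * norm (0::complex) / norm (1::complex) ^ (k + 1) * E"
      by (intro tendsto_intros s0 r1) simp
    then show ?thesis using Lim_null_comparison[OF ev] by simp
  qed
  have rec: "e n (Suc m) - e n m
      = \<delta> n * e n m - B n * (e n m - e n (Suc m - k)) + C n * (e n m - e n (m - k))" if m_ge: "k \<le> m" for n m
  proof -
    obtain j where m: "m = k + j" using le_Suc_ex[OF m_ge] by blast
    define D where "D = 2 * (2 ^ m * r n ^ m) * r n"
    let ?Q = "part_poly k (Suc m - k) (exp (s n))" and ?R = "part_poly k (m - k) (exp (s n))"
    have next_e: "e n (Suc m) = e n m / r n + w n * (?Q - ?R) / D"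
      unfolding e_def part_poly_recurrence[OF k m_ge] w_def[symmetric]
      by (simp add: D_def add_divide_distrib mult_ac)
    have B: "B n * e n (Suc m - k) = w n * ?Q / D"
      by (simp add: B_def e_def D_def m power_add mult_ac)
    have C: "C n * e n (m - k) = w n * ?R / D"
      by (simp add: C_def e_def D_def m power_add mult_ac)
    have "\<delta> n * e n m - B n * (e n m - e n (Suc m - k)) + C n * (e n m - e n (m - k))
        = e n m / r n - e n m + B n * e n (Suc m - k) - C n * e n (m - k)"
      by (simp add: \<delta>_def algebra_simps)
    then show ?thesis unfolding next_e B C by (simp add: right_diff_distrib diff_divide_distrib)
  qed
  have E: "norm (e n m) \<le> E" if "m \<le> n" for n m
  proof -
    have rm: "norm (r n) ^ m = exp (- (var_rate k / 2 * (real m * (norm (s n))\<^sup>2)))"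
      unfolding r_def norm_exp_log_growth[OF imag] exp_of_nat_mult[symmetric]
      by (simp only: mult_minus_right mult.left_commute)
    have "norm (part_poly k m (exp (s n))) \<le> 2 ^ m" by (rule norm_part_poly_le[OF unit])
    then have "norm (e n m) \<le> 2 ^ m / (2 ^ m * norm (r n) ^ m)"
      unfolding e_def norm_divide norm_mult norm_power
      by (simp only: norm_numeral, intro divide_right_mono) auto
    also have "\<dots> = exp (var_rate k / 2 * (real m * (norm (s n))\<^sup>2))"
      unfolding rm by (simp add: exp_minus inverse_eq_divide)
    also have "real m * (norm (s n))\<^sup>2 \<le> K"
      using mult_right_mono[of "real m" "real n" "(norm (s n))\<^sup>2"] bounded[of n] that by simp
    then have "exp (var_rate k / 2 * (real m * (norm (s n))\<^sup>2)) \<le> E"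
      using var_rate_pos[of k] by (simp add: E_def)
    finally show ?thesis .
  qed
  have ek: "(\<lambda>n. e n k) \<longlonglongrightarrow> 1 / 2"
  proof -
    have "(\<lambda>n. e n k) \<longlonglongrightarrow> (\<Sum>xs\<in>compositions k. exp 0 ^ count_list xs k) / (2 ^ k * 1 ^ k)"
      unfolding e_def part_poly_def by (intro tendsto_intros s0 r1) simp
    moreover have "card (compositions k) = 2 ^ (k - 1)"
      using card_compositions_Suc[of "k - 1"] k by simp
    moreover have "(2::complex) ^ k = 2 * 2 ^ (k - 1)"
      using k by (cases k) auto
    ultimately show ?thesis by simp
  qed
  have "(\<lambda>n. e n n - e n k) \<longlonglongrightarrow> 0"
  proof (rule Lim_null_comparison)
    have "\<forall>\<^sub>F n in sequentially. q n < 1 / 2" by (rule order_tendstoD(2)[OF q0]) simp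
    then show "\<forall>\<^sub>F n in sequentially. norm (e n n - e n k) \<le> X n + 2 * q n * (2 * real k * E + X n)"
      using eventually_ge_at_top[of k]
    proof eventually_elim
      case (elim n)
      show ?case
        unfolding X_def q_def
      proof (rule perturbed_recurrence_nearly_constant[OF k _ rec E])
        show "real k * (norm (B n) + norm (C n)) \<le> 1 / 2" using elim by (simp add: q_def)
      qed (use elim in auto)
    qed
    have "(\<lambda>n. X n + 2 * q n * (2 * real k * E + X n)) \<longlonglongrightarrow> 0 + 2 * 0 * (2 * real k * E + 0)"
      by (intro tendsto_intros X0 q0)
    then show "(\<lambda>n. X n + 2 * q n * (2 * real k * E + X n)) \<longlonglongrightarrow> 0" by simp
  qed
  from tendsto_add[OF this ek] have "(\<lambda>n. e n n) \<longlonglongrightarrow> 1 / 2" by simp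
  then show ?thesis by (simp add: e_def r_def exp_of_nat_mult)
qed

section \<open>Characteristic functions of the normalised counts\<close>

lemma char_part_count:
  assumes "1 \<le> n"
  shows "char (distr (measure_pmf (random_composition n)) borel
      (\<lambda>xs. (real (count_list xs k) - \<mu>) / \<sigma>)) t
    = part_poly k n (exp (\<i> * of_real (t / \<sigma>))) * exp (- (\<i> * of_real (t / \<sigma>) * of_real \<mu>)) / 2 ^ (n - 1)"
proof -
  define s where "s = \<i> * complex_of_real (t / \<sigma>)"
  have card: "card (compositions n) = 2 ^ (n - 1)"
    using card_compositions_Suc[of "n - 1"] assms by simp
  have exp_eq: "iexp (t * ((real c - \<mu>) / \<sigma>)) = exp s ^ c * exp (- (s * of_real \<mu>))" for c
    by (simp add: s_def field_simps diff_divide_distrib flip: exp_of_nat_mult exp_add)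
  have "char (distr (measure_pmf (random_composition n)) borel
      (\<lambda>xs. (real (count_list xs k) - \<mu>) / \<sigma>)) t
    = (CLINT xs|measure_pmf (random_composition n). exp s ^ count_list xs k * exp (- (s * of_real \<mu>)))"
    unfolding char_def by (subst integral_distr) (simp_all only: exp_eq, simp_all)
  also have "\<dots> = (\<Sum>xs\<in>compositions n. (exp s ^ count_list xs k * exp (- (s * of_real \<mu>))) / 2 ^ (n - 1))"
    by (subst integral_measure_pmf[OF finite_compositions[of n]])
      (auto simp: random_composition_def set_pmf_of_set pmf_of_set compositions_nonempty
        finite_compositions card scaleR_conv_of_real)
  also have "\<dots> = part_poly k n (exp s) * exp (- (s * of_real \<mu>)) / 2 ^ (n - 1)"
    by (simp add: part_poly_def sum_distrib_right sum_divide_distrib)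
  finally show ?thesis by (simp only: s_def)
qed

lemma var_parts_over_n: "(\<lambda>n. var_parts n k / real n) \<longlonglongrightarrow> var_rate k"
proof -
  define c where "c = (3 * real k * (real k - 4) + (3 - real k) * 2 ^ (k + 1) + 5) / 4 ^ (k + 1)"
  have "(\<lambda>n. var_rate k + c / real n) \<longlonglongrightarrow> var_rate k + 0"
    by (intro tendsto_intros lim_const_over_n)
  moreover have "\<forall>\<^sub>F n in sequentially. var_rate k + c / real n = var_parts n k / real n"
    using eventually_gt_at_top[of 0]
    by eventually_elim (simp add: var_rate_def var_parts_def c_def field_simps)
  ultimately have "(\<lambda>n. var_parts n k / real n) \<longlonglongrightarrow> var_rate k + 0"
    by (rule Lim_transform_eventually)
  then show ?thesis by simp
qed

theorem corollary2p15:
  fixes k :: nat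
  assumes "k \<ge> 1"
  shows "weak_conv_m
           (\<lambda>n. distr (measure_pmf (random_composition n)) borel
                  (\<lambda>xs. (real (count_list xs k) - mean_parts n k) / sd_parts n k))
           std_normal_distribution"
proof (rule levy_continuity)
  show "real_distribution (distr (measure_pmf (random_composition n)) borel
      (\<lambda>xs. (real (count_list xs k) - mean_parts n k) / sd_parts n k))" for n
    by (rule prob_space.real_distribution_distr[OF prob_space_measure_pmf]) simp
  show "real_distribution std_normal_distribution" by (rule real_dist_normal_dist)
next
  fix t :: real
  define v where "v = var_rate k"
  define s where "s n = \<i> * complex_of_real (t / sd_parts n k)" for n
  \<comment> \<open>The constant by which the leading term \<open>n / 2^(k + 1)\<close> exceeds the mean.\<close>
  define c where "c = (real k - 3) / 2 ^ (k + 1)"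
  define G where "G n = part_poly k n (exp (s n)) / (2 ^ n * exp (of_nat n * log_growth k (s n)))" for n
  have v: "v > 0" by (simp add: v_def var_rate_pos)
  have "(\<lambda>n. inverse (var_parts n k / real n)) \<longlonglongrightarrow> inverse v"
    using var_parts_over_n[of k] v unfolding v_def by (intro tendsto_inverse) auto
  then have ratio: "(\<lambda>n. real n / var_parts n k) \<longlonglongrightarrow> 1 / v"
    by (simp add: inverse_eq_divide)
  \<comment> \<open>The absolute value is needed for the finitely many \<open>n\<close> whose \<open>var_parts\<close> is negative: there
    the square root is negative, and its square is \<open>- var_parts n k\<close>.\<close>
  have norm_s: "real n * (norm (s n))\<^sup>2 = \<bar>t\<^sup>2 * (real n / var_parts n k)\<bar>" for n
  proof -
    have "(sqrt x)\<^sup>2 = \<bar>x\<bar>" for x :: real by (metis real_sqrt_abs real_sqrt_power)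
    then show ?thesis
      by (simp add: s_def norm_mult norm_divide power_divide sd_parts_def abs_mult)
  qed
  have var_pos: "\<forall>\<^sub>F n in sequentially. 0 < var_parts n k"
  proof -
    have "\<forall>\<^sub>F n in sequentially. 0 < var_parts n k / real n"
      using order_tendstoD(1)[OF var_parts_over_n var_rate_pos] .
    then show ?thesis by eventually_elim (auto simp: zero_less_divide_iff)
  qed
  have "Bseq (\<lambda>n. t\<^sup>2 * (real n / var_parts n k))"
    using tendsto_mult[OF tendsto_const ratio] by (intro convergent_imp_Bseq) (rule convergentI)
  then obtain K where "0 < K" and "\<forall>n. norm (t\<^sup>2 * (real n / var_parts n k)) \<le> K"
    by (rule BseqE)
  then have K: "real n * (norm (s n))\<^sup>2 \<le> K" for n
    by (simp only: norm_s real_norm_def)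
  have G: "G \<longlonglongrightarrow> 1 / 2"
    unfolding G_def by (rule part_poly_asymptotic[OF assms _ K]) (simp add: s_def)
  have s0: "s \<longlonglongrightarrow> 0"
    by (rule tendsto_zero_if_scaled_norm_bounded[OF K])
  have "(\<lambda>n. 2 * G n * exp (s n * of_real c - of_real (v / 2 * t\<^sup>2 * (real n / var_parts n k))))
      \<longlonglongrightarrow> 2 * (1 / 2) * exp (0 * of_real c - of_real (v / 2 * t\<^sup>2 * (1 / v)))"
    by (intro tendsto_intros G s0 ratio)
  also have "2 * (1 / 2) * exp (0 * of_real c - of_real (v / 2 * t\<^sup>2 * (1 / v))) = char std_normal_distribution t"
    using v by (simp add: char_std_normal_distribution flip: exp_of_real)
  finally have lim: "(\<lambda>n. 2 * G n * exp (s n * of_real c - of_real (v / 2 * t\<^sup>2 * (real n / var_parts n k))))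
      \<longlonglongrightarrow> char std_normal_distribution t" .
  have "\<forall>\<^sub>F n in sequentially.
      2 * G n * exp (s n * of_real c - of_real (v / 2 * t\<^sup>2 * (real n / var_parts n k)))
      = char (distr (measure_pmf (random_composition n)) borel
          (\<lambda>xs. (real (count_list xs k) - mean_parts n k) / sd_parts n k)) t"
    using var_pos eventually_ge_at_top[of 1]
  proof eventually_elim
    case (elim n)
    have "(s n)\<^sup>2 = - of_real (t\<^sup>2 / var_parts n k)"
      using elim by (simp add: s_def power_mult_distrib power_divide sd_parts_def flip: of_real_power)
    moreover have "of_nat n * log_growth k (s n) - s n * of_real (mean_parts n k)
        = s n * of_real c + of_real (v / 2) * of_nat n * (s n)\<^sup>2"
      by (simp add: log_growth_def mean_parts_def c_def v_def field_simps)
    ultimately have exponent: "s n * of_real c - of_real (v / 2 * t\<^sup>2 * (real n / var_parts n k))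
        = of_nat n * log_growth k (s n) - s n * of_real (mean_parts n k)"
      by simp
    have two: "(2::complex) ^ n = 2 * 2 ^ (n - 1)" using elim by (cases n) auto
    have "2 * G n * exp (s n * of_real c - of_real (v / 2 * t\<^sup>2 * (real n / var_parts n k)))
      = part_poly k n (exp (s n)) * exp (- (s n * of_real (mean_parts n k))) / 2 ^ (n - 1)"
      unfolding exponent G_def exp_diff exp_minus two by (simp add: field_simps)
    then show ?case using elim by (simp only: char_part_count s_def)
  qed
  with lim show "(\<lambda>n. char (distr (measure_pmf (random_composition n)) borel
      (\<lambda>xs. (real (count_list xs k) - mean_parts n k) / sd_parts n k)) t)
      \<longlonglongrightarrow> char std_normal_distribution t"
    by (rule Lim_transform_eventually)
qed

end
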